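(* Suppose that $b=\lceil xN \rceil$ and $w=\lfloor (1-x)N \rfloor$ for $N\in\mathbb{Z}^+$ and some fixed $\frac{1}{2}<x<1$. Then as $N\to\infty$, $$V^A(w,b) \sim V(w,b) \sim N,$$ $$T^A(w,b) \sim T(w,b) \sim \frac{N}{2} \ln\left(\frac{1}{2x-1}\right).$$
   Context: Mabinogion urn model (M-process): an urn contains white and black balls. At each time $1,2,3,\dots$ one ball is drawn uniformly at random from the urn, independently of previous selections, its color is observed and it is returned. If the drawn ball is white, one black ball is replaced by a white one; if it is black, one white ball is replaced by a black one. So from a state with $w>0$ white and $b>0$ black balls, a draw leads to $(w+1,b-1)$ with probability $\frac{w}{w+b}$ and to $(w-1,b+1)$ with probability $\frac{b}{w+b}$. The process stops (is absorbed) when all remaining balls are of the same color. For the M-process started with $w$ white and $b$ black balls, $V(w,b)$ is the expected number of black balls at absorption and $T(w,b)$ is the expected time to absorption (number of draws). Policy A: at time $0$ and immediately after each draw, if the number of white balls is greater than or equal to the number of black balls, immediately reduce (by permanently removing white balls) the number of white balls to one less than the number of black balls; otherwise do nothing. Removals take no time. $V^A(w,b)$ and $T^A(w,b)$ denote the expected final number of black balls and the expected time to absorption when Policy A is applied throughout (including at time $0$), starting with $w$ white and $b$ black balls. The notation $f(N)\sim g(N)$ means $\lim_{N\to\infty} f(N)/g(N)=1$. *)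

theory Defs
  imports "HOL-Probability.Probability" "HOL-Library.Landau_Symbols"
begin

text \<open>A state \<open>(w, b)\<close> is an urn with \<open>w\<close> white and \<open>b\<close> black balls.\<close>

type_synonym urn = "nat \<times> nat"

fun absorbed :: "urn \<Rightarrow> bool" where
  "absorbed (w, b) \<longleftrightarrow> w = 0 \<or> b = 0"

text \<open>
  The randomness is a sequence of independent variables uniform on \<open>[0, 1)\<close>.  If the balls in the
  urn are numbered \<open>0, \<dots>, w + b - 1\<close> with the white ones first, then \<open>u\<close> selects
  ball number \<open>\<lfloor>u (w + b)\<rfloor>\<close>, which is white iff \<open>u (w + b) < w\<close>; this has
  probability \<open>w / (w + b)\<close>.
\<close>

definition draws :: "(nat \<Rightarrow> real) measure" where
  "draws = (\<Pi>\<^sub>M n\<in>UNIV. uniform_measure lborel {0..<1})"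

fun draw :: "real \<Rightarrow> urn \<Rightarrow> urn" where
  "draw u (w, b) =
     (if absorbed (w, b) then (w, b)
      else if u * real (w + b) < real w then (w + 1, b - 1)
      else (w - 1, b + 1))"

text \<open>
  State after \<open>n\<close> draws (and the subsequent intervention), when the intervention \<open>p\<close> is
  applied at time 0 and immediately after each draw.
\<close>

primrec urn_process :: "(urn \<Rightarrow> urn) \<Rightarrow> urn \<Rightarrow> (nat \<Rightarrow> real) \<Rightarrow> nat \<Rightarrow> urn" where
  "urn_process p s U 0 = p s"
| "urn_process p s U (Suc n) = p (draw (U n) (urn_process p s U n))"

text \<open>The infimum of the empty set is \<open>\<infinity>\<close>: the time is infinite without absorption.\<close>

definition absorption_time :: "(urn \<Rightarrow> urn) \<Rightarrow> urn \<Rightarrow> (nat \<Rightarrow> real) \<Rightarrow> enat" where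
  "absorption_time p s U = (INF n\<in>{n. absorbed (urn_process p s U n)}. enat n)"

text \<open>The value 0 without absorption is a convention; that event is null for the processes below.\<close>

definition final_black :: "(urn \<Rightarrow> urn) \<Rightarrow> urn \<Rightarrow> (nat \<Rightarrow> real) \<Rightarrow> nat" where
  "final_black p s U =
     (case absorption_time p s U of enat n \<Rightarrow> snd (urn_process p s U n) | \<infinity> \<Rightarrow> 0)"

definition expected_final_black :: "(urn \<Rightarrow> urn) \<Rightarrow> urn \<Rightarrow> real" where
  "expected_final_black p s = (\<integral>U. real (final_black p s U) \<partial>draws)"

definition expected_absorption_time :: "(urn \<Rightarrow> urn) \<Rightarrow> urn \<Rightarrow> ennreal" where
  "expected_absorption_time p s = (\<integral>\<^sup>+U. ennreal_of_enat (absorption_time p s U) \<partial>draws)"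

text \<open>
  The guard \<open>0 < b\<close> leaves an urn without black balls, which is already absorbed, unchanged;
  there \<open>b - 1\<close> would be negative.
\<close>

fun policyA :: "urn \<Rightarrow> urn" where
  "policyA (w, b) = (if 0 < b \<and> b \<le> w then (b - 1, b) else (w, b))"

definition V :: "nat \<Rightarrow> nat \<Rightarrow> real" where
  "V w b = expected_final_black id (w, b)"

definition VA :: "nat \<Rightarrow> nat \<Rightarrow> real" where
  "VA w b = expected_final_black policyA (w, b)"

text \<open>
  Since \<^term>\<open>enn2real\<close> maps \<open>\<infinity>\<close> to 0, asymptotic equivalence of \<open>T\<close> or \<open>TA\<close> to an eventually
  positive function includes the claim that the expectation is eventually finite.
\<close>

definition T :: "nat \<Rightarrow> nat \<Rightarrow> real" where
  "T w b = enn2real (expected_absorption_time id (w, b))"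

definition TA :: "nat \<Rightarrow> nat \<Rightarrow> real" where
  "TA w b = enn2real (expected_absorption_time policyA (w, b))"

end

theory Submission imports Defs "HOL-Real_Asymp.Real_Asymp" begin

text \<open>
  Let \<open>D = b - w\<close>. A draw changes \<open>D\<close> by \<open>\<plusminus>2\<close> with mean drift \<open>2 D / (w + b)\<close>, so \<open>D\<close> grows
  exponentially and reaches \<open>N\<close> from \<open>y N\<close>, where \<open>y = 2 x - 1\<close>, after about \<open>(N / 2) ln (1 / y)\<close>
  draws. Explicit Lyapunov functions make this rigorous, for the process with and without Policy A
  alike. With \<open>S(D) = D\<^sup>2 + 3 N - 4\<close>, the function \<open>1 / S\<close> is superharmonic in every urn with at most \<open>N\<close>
  balls, and the decrease is large enough for \<open>(N / 4) ln ((N\<^sup>2 + 3 N) / S) + 6 N\<^sup>2 / S\<close> to bound the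
  absorption time from above. By concavity of \<open>ln\<close>, the function \<open>(N / 2) ln (N / D)\<close> drops by at most
  \<open>1\<close> per draw in the mean; subtracting a multiple of \<open>1 / S\<close> makes it nonpositive for \<open>D \<le> 2\<close>, that is,
  before Policy A can interfere, and its positive part bounds the absorption time from below. Finally
  \<open>min N (3 N\<^sup>2 / S)\<close>, replaced by \<open>N\<close> where white has caught up or a ball was removed, bounds the
  expected number of black balls missing at absorption, which is thus bounded in \<open>N\<close>.
\<close>

section \<open>Lyapunov functions of the imbalance\<close>

text \<open>
  The additive constant \<open>3 * n - 4\<close> makes the reciprocal superharmonic at every \<open>D\<close>, including the
  region \<open>D\<^sup>2 = O(n)\<close> where the noise outweighs the drift.
\<close>

definition shifted_square :: "real \<Rightarrow> real \<Rightarrow> real" where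
  "shifted_square n D = D\<^sup>2 + 3 * n - 4"

lemma shifted_square_pos: "2 \<le> n \<Longrightarrow> 0 < shifted_square n D"
  unfolding shifted_square_def using zero_le_power2[of D] by linarith

lemma shifted_square_mono: "\<bar>D\<bar> \<le> \<bar>D'\<bar> \<Longrightarrow> shifted_square n D \<le> shifted_square n D'"
  by (simp add: shifted_square_def abs_le_square_iff)

text \<open>With \<open>d = D^2\<close> and \<open>R = d + 3 * n\<close>, the values of
  \<open>shifted_square\<close> at \<open>D + 2\<close>, \<open>D - 2\<close> and \<open>D\<close>
  are \<open>R + 4 * D\<close>, \<open>R - 4 * D\<close> and \<open>R - 4\<close>, and
  \<open>b - w = D\<close> turns the mean of the reciprocals into a rational function of
  \<open>d\<close>, \<open>n\<close> and \<open>w + b\<close>. The guaranteed relative decrease is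
  about \<open>4 / n\<close> for \<open>d\<close> far above \<open>n\<close>, but only
  \<open>4 / (9 * n)\<close> at \<open>D = 0\<close>.\<close>

lemma recip_drift:
  fixes w b n :: real
  assumes "0 < w" "0 < b" "w + b \<le> n" "2 \<le> n"
  defines "D \<equiv> b - w"
  shows "shifted_square n D * (b / (w + b) / shifted_square n (D + 2) + w / (w + b) / shifted_square n (D - 2))
    \<le> 1 - 4 * (D\<^sup>2 + 3 * n) / (n * (D\<^sup>2 + 27 * n))"
proof -
  define d R where "d = D\<^sup>2" and "R = d + 3 * n"
  have d: "0 \<le> d" by (simp add: d_def)
  have plus: "shifted_square n (D + 2) = R + 4 * D" and minus: "shifted_square n (D - 2) = R - 4 * D"
    and S: "shifted_square n D = R - 4"
    by (simp_all add: shifted_square_def R_def d_def power2_eq_square algebra_simps)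
  have pos: "0 < R + 4 * D" "0 < R - 4 * D" "0 < R - 4"
    using shifted_square_pos[OF \<open>2 \<le> n\<close>] by (metis plus minus S)+
  have prod: "(R + 4 * D) * (R - 4 * D) = R\<^sup>2 - 16 * d"
    by (simp add: d_def power2_eq_square algebra_simps)
  have den: "0 < R\<^sup>2 - 16 * d"
    using pos prod by (metis mult_pos_pos)
  have "b / (w + b) / (R + 4 * D) + w / (w + b) / (R - 4 * D)
      = (b * (R - 4 * D) + w * (R + 4 * D)) / ((w + b) * ((R + 4 * D) * (R - 4 * D)))"
  proof -
    have "q / L / x + r / L / y = (q * y + r * x) / (L * (x * y))" if "0 < L" "0 < x" "0 < y" for q r x y L :: real
      using that by (simp add: field_simps)
    then show ?thesis using pos assms by simp
  qed
  also have "b * (R - 4 * D) + w * (R + 4 * D) = (w + b) * (R - 4 * d / (w + b))"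
    using assms by (simp add: d_def D_def field_simps power2_eq_square)
  also have "\<dots> / ((w + b) * ((R + 4 * D) * (R - 4 * D))) = (R - 4 * d / (w + b)) / (R\<^sup>2 - 16 * d)"
    unfolding prod using assms(1,2) by simp
  \<comment> \<open>Fewer balls mean a stronger drift at the same \<open>D\<close>, so
    \<open>w + b = n\<close> is the worst case.\<close>
  also have "\<dots> \<le> (R - 4 * d / n) / (R\<^sup>2 - 16 * d)"
    using assms d den by (intro divide_right_mono diff_left_mono divide_left_mono) auto
  finally have "(R - 4) * (b / (w + b) / (R + 4 * D) + w / (w + b) / (R - 4 * D))
      \<le> (R - 4) * ((R - 4 * d / n) / (R\<^sup>2 - 16 * d))"
    using pos by (intro mult_left_mono) auto
  also have "\<dots> \<le> 1 - 4 * R / (n * (d + 27 * n))"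
  proof -
    \<comment> \<open>Clearing denominators leaves a polynomial. As \<open>n \<ge> 2\<close> gives
      \<open>240 * d \<le> 120 * d * n\<close>, its bracket is at least
      \<open>72 * (d - 3 / 2 * n)^2 + 54 * n^2\<close>.\<close>
    have "(n * (d + 27 * n) - 4 * R) * (R\<^sup>2 - 16 * d) - (R - 4) * (n * R - 4 * d) * (d + 27 * n)
       = n * (72 * d\<^sup>2 - 96 * d * n + 216 * n\<^sup>2 - 240 * d) + 48 * d\<^sup>2"
      by (simp add: R_def power2_eq_square algebra_simps)
    also have "\<dots> \<ge> 0"
    proof -
      have "d * 2 \<le> d * n" using assms d by (intro mult_left_mono) auto
      moreover have "0 \<le> 72 * (d - 3 / 2 * n)\<^sup>2" by simp
      then have "0 \<le> 72 * d\<^sup>2 - 216 * (d * n) + 162 * n\<^sup>2"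
        by (simp add: power2_eq_square algebra_simps)
      moreover have "0 \<le> n\<^sup>2" by simp
      ultimately have "0 \<le> 72 * d\<^sup>2 - 96 * (d * n) + 216 * n\<^sup>2 - 240 * d" by linarith
      then show ?thesis using assms by (simp add: mult.assoc)
    qed
    finally have le: "(R - 4) * (n * R - 4 * d) * (d + 27 * n) \<le> (n * (d + 27 * n) - 4 * R) * (R\<^sup>2 - 16 * d)"
      by simp
    have pos': "0 < d + 27 * n" "0 < n" using d assms by auto
    have "(R - 4) * ((R - 4 * d / n) / E) = (R - 4) * (n * R - 4 * d) * e / (n * e * E)"
      "1 - 4 * R / (n * e) = (n * e - 4 * R) * E / (n * e * E)" if "0 < e" "0 < E" for e E
      using that pos'(2) by (simp_all add: field_simps)
    note eqs = this[OF pos'(1) den]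
    show ?thesis unfolding eqs using le den pos' by (intro divide_right_mono) auto
  qed
  finally show ?thesis by (simp add: plus minus S R_def d_def algebra_simps)
qed

lemma recip_superharmonic:
  fixes w b n :: real
  assumes "0 < w" "0 < b" "w + b \<le> n" "2 \<le> n"
  defines "D \<equiv> b - w"
  shows "b / (w + b) / shifted_square n (D + 2) + w / (w + b) / shifted_square n (D - 2)
    \<le> 1 / shifted_square n D"
proof -
  have "0 \<le> 4 * (D\<^sup>2 + 3 * n) / (n * (D\<^sup>2 + 27 * n))"
    using assms by auto
  with recip_drift[OF assms(1-4)] have "shifted_square n D * (b / (w + b) / shifted_square n (D + 2) + w / (w + b) / shifted_square n (D - 2)) \<le> 1"
    unfolding D_def by linarith
  then show ?thesis using shifted_square_pos[OF \<open>2 \<le> n\<close>, of D] by (simp add: field_simps)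
qed

text \<open>The numerator \<open>n^2 + 3 * n\<close> exceeds \<open>shifted_square n n\<close>,
  which keeps the logarithm nonnegative for \<open>\<bar>D\<bar> \<le> n\<close>. The second summand
  makes up for the weak decrease of the reciprocal where \<open>D^2\<close> is of order
  \<open>n\<close>; at \<open>D = y * n\<close> it stays bounded.\<close>

definition upper_time :: "real \<Rightarrow> real \<Rightarrow> real" where
  "upper_time n D = n / 4 * ln ((n\<^sup>2 + 3 * n) / shifted_square n D) + 6 * n\<^sup>2 / shifted_square n D"

lemma upper_time_drift:
  fixes w b n :: real
  assumes "0 < w" "0 < b" "w + b \<le> n" "2 \<le> n"
  defines "D \<equiv> b - w"
  shows "1 + b / (w + b) * upper_time n (D + 2) + w / (w + b) * upper_time n (D - 2) \<le> upper_time n D"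
proof -
  define q r where "q = b / (w + b)" and "r = w / (w + b)"
  have qr: "0 \<le> q" "0 \<le> r" "q + r = 1" using assms by (auto simp: q_def r_def add_divide_distrib[symmetric])
  let ?S = "shifted_square n"
  define Z where "Z = q / ?S (D + 2) + r / ?S (D - 2)"
  define Y where "Y = 1 - ?S D * Z"
  have Spos: "\<And>x. 0 < ?S x" using assms shifted_square_pos by auto
  have num: "0 < n\<^sup>2 + 3 * n" using assms by (intro add_pos_pos) auto
  \<comment> \<open>The tangent of \<open>ln\<close> at 1 bounds \<open>upper_time\<close> by an
    affine function of \<open>1 / ?S x\<close>, so that only the mean \<open>Z\<close> of the
    reciprocals matters.\<close>
  have bound: "upper_time n x \<le> n / 4 * (ln ((n\<^sup>2 + 3 * n) / ?S D) - 1 + ?S D / ?S x) + 6 * n\<^sup>2 / ?S x" for x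
  proof -
    have "ln ((n\<^sup>2 + 3 * n) / ?S x) = ln ((n\<^sup>2 + 3 * n) / ?S D) + ln (?S D / ?S x)"
      using Spos[of x] Spos[of D] num by (simp add: ln_div)
    moreover have "ln (?S D / ?S x) \<le> ?S D / ?S x - 1"
      using Spos by (intro ln_le_minus_one) auto
    ultimately show ?thesis unfolding upper_time_def using assms
      by (intro add_right_mono mult_left_mono) auto
  qed
  have "q * upper_time n (D + 2) + r * upper_time n (D - 2)
    \<le> q * (n / 4 * (ln ((n\<^sup>2 + 3 * n) / ?S D) - 1 + ?S D / ?S (D + 2)) + 6 * n\<^sup>2 / ?S (D + 2))
     + r * (n / 4 * (ln ((n\<^sup>2 + 3 * n) / ?S D) - 1 + ?S D / ?S (D - 2)) + 6 * n\<^sup>2 / ?S (D - 2))"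
    by (intro add_mono mult_left_mono bound qr)
  also have "\<dots> = (q + r) * (n / 4 * (ln ((n\<^sup>2 + 3 * n) / ?S D) - 1)) + n / 4 * (?S D * Z) + 6 * n\<^sup>2 * Z"
    by (simp add: Z_def algebra_simps add_divide_distrib diff_divide_distrib)
  also have "\<dots> = upper_time n D - Y * (n / 4 + 6 * n\<^sup>2 / ?S D)"
    using Spos[of D] by (simp add: Y_def upper_time_def qr field_simps)
  also have "\<dots> \<le> upper_time n D - 1"
  proof -
    have Y: "4 * (D\<^sup>2 + 3 * n) / (n * (D\<^sup>2 + 27 * n)) \<le> Y"
      using recip_drift[OF assms(1-4)] by (simp add: Y_def Z_def D_def q_def r_def)
    have "0 < D\<^sup>2 + 27 * n" using assms by (intro add_nonneg_pos) auto
    \<comment> \<open>The factor \<open>n / 4 + 6 * n^2 / ?S D\<close> equals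
      \<open>n * (?S D + 24 * n) / (4 * ?S D)\<close>, hence the constant
      \<open>27 = 3 + 24\<close>. The two sides differ by exactly \<open>96 * n\<close>.\<close>
    moreover have "(D\<^sup>2 + 27 * n) * ?S D \<le> (D\<^sup>2 + 3 * n) * (?S D + 24 * n)"
      using assms by (simp add: shifted_square_def algebra_simps)
    ultimately have "1 \<le> (D\<^sup>2 + 3 * n) * (?S D + 24 * n) / ((D\<^sup>2 + 27 * n) * ?S D)"
      using Spos[of D] by simp
    also have "\<dots> = 4 * (D\<^sup>2 + 3 * n) / (n * (D\<^sup>2 + 27 * n)) * (n / 4 + 6 * n\<^sup>2 / ?S D)"
      using Spos[of D] assms \<open>0 < D\<^sup>2 + 27 * n\<close> by (simp add: divide_simps power2_eq_square) (simp add: algebra_simps)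
    also have "\<dots> \<le> Y * (n / 4 + 6 * n\<^sup>2 / ?S D)"
      using Spos[of D] assms by (intro mult_right_mono Y) auto
    finally show ?thesis by simp
  qed
  finally show ?thesis by (simp add: q_def r_def)
qed

text \<open>This absorbs interventions: a removal that does not reduce the absolute imbalance cannot
  raise the bound, as \<open>n\<close> stays fixed.\<close>

lemma upper_time_antimono:
  assumes "\<bar>D\<bar> \<le> \<bar>D'\<bar>" "2 \<le> n"
  shows "upper_time n D' \<le> upper_time n D"
proof -
  have S: "0 < shifted_square n D" "shifted_square n D \<le> shifted_square n D'"
    using assms shifted_square_pos shifted_square_mono by auto
  have "0 < n\<^sup>2 + 3 * n" using assms by (intro add_pos_pos) auto
  then show ?thesis unfolding upper_time_def using S assms
    by (intro add_mono mult_left_mono divide_left_mono ln_mono divide_pos_pos mult_pos_pos) auto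
qed

lemma upper_time_nonneg:
  assumes "\<bar>D\<bar> \<le> n" "2 \<le> n"
  shows "0 \<le> upper_time n D"
proof -
  have "shifted_square n D \<le> n\<^sup>2 + 3 * n"
    using assms shifted_square_mono[of D n n] by (simp add: shifted_square_def)
  then show ?thesis unfolding upper_time_def using shifted_square_pos[of n D] assms
    by (intro add_nonneg_nonneg mult_nonneg_nonneg) auto
qed

text \<open>Since \<open>shifted_square n 2 = 3 * n\<close>, the coefficient
  \<open>3 / 2 * n^2 * ln n\<close> is just large enough for the correction to outweigh
  \<open>n / 2 * ln n\<close> at \<open>D \<le> 2\<close>. At \<open>D = y * n\<close> it is only of
  order \<open>ln n\<close>.\<close>

definition lower_time :: "real \<Rightarrow> real \<Rightarrow> real" where
  "lower_time n D = n / 2 * ln (n / D) - 3 / 2 * n\<^sup>2 * ln n / shifted_square n D"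

text \<open>Tangents give \<open>ln (D + 2) - ln D \<le> 2 / D\<close> and
  \<open>ln (D - 2) - ln D \<le> - 2 / D\<close>. Averaging multiplies \<open>2 / D\<close> by the
  mean direction \<open>(b - w) / n = D / n\<close>, so the logarithm gains at most
  \<open>2 / n\<close>; the correction term helps by superharmonicity.\<close>

lemma lower_time_drift:
  fixes w b n :: real
  assumes "0 < w" "0 < b" "w + b = n" "2 \<le> n"
  defines "D \<equiv> b - w"
  assumes "2 < D"
  shows "lower_time n D \<le> 1 + b / n * lower_time n (D + 2) + w / n * lower_time n (D - 2)"
proof -
  let ?S = "shifted_square n"
  have "b / n * (ln (D + 2) - ln D) + w / n * (ln (D - 2) - ln D) \<le> b / n * (2 / D) + w / n * (- 2 / D)"
  proof (intro add_mono mult_left_mono)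
    show "ln (D + 2) - ln D \<le> 2 / D"
      using ln_le_minus_one[of "(D + 2) / D"] \<open>2 < D\<close> by (simp add: ln_div field_simps)
    show "ln (D - 2) - ln D \<le> - 2 / D"
      using ln_le_minus_one[of "(D - 2) / D"] \<open>2 < D\<close> by (simp add: ln_div field_simps)
  qed (use assms in auto)
  also have "\<dots> = D / n * (2 / D)"
    unfolding D_def by (simp add: diff_divide_distrib left_diff_distrib)
  also have "\<dots> = 2 / n"
    using \<open>2 < D\<close> by simp
  finally have A: "b / n * ln (D + 2) + w / n * ln (D - 2) - (b / n + w / n) * ln D \<le> 2 / n"
    by (simp add: algebra_simps)
  have bw: "b / n + w / n = 1" using assms by (simp add: add_divide_distrib[symmetric])
  have "n / 2 * (b / n * ln (D + 2) + w / n * ln (D - 2) - ln D) \<le> n / 2 * (2 / n)"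
    using A assms unfolding bw by (intro mult_left_mono) auto
  also have "n / 2 * (2 / n) = 1" using assms by simp
  finally have A': "n / 2 * (b / n * ln (D + 2) + w / n * ln (D - 2) - ln D) \<le> 1" .
  define K where "K = 3 / 2 * n\<^sup>2 * ln n"
  have "0 \<le> K" using assms by (simp add: K_def)
  then have B: "K * (b / n / ?S (D + 2) + w / n / ?S (D - 2)) \<le> K * (1 / ?S D)"
    using recip_superharmonic[OF assms(1,2) _ assms(4)] assms(3) by (intro mult_left_mono) (auto simp: D_def)
  have eq: "lower_time n x = n / 2 * (ln n - ln x) - K * (1 / ?S x)" if "0 < x" for x
    using that assms by (simp add: lower_time_def ln_div K_def)
  have "b / n * lower_time n (D + 2) + w / n * lower_time n (D - 2)
    = n / 2 * ((b / n + w / n) * ln n - (b / n * ln (D + 2) + w / n * ln (D - 2))) - K * (b / n / ?S (D + 2) + w / n / ?S (D - 2))"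
    using \<open>2 < D\<close> by (simp add: eq algebra_simps)
  also have "\<dots> = lower_time n D + K * (1 / ?S D) - n / 2 * (b / n * ln (D + 2) + w / n * ln (D - 2) - ln D) - K * (b / n / ?S (D + 2) + w / n / ?S (D - 2))"
    using \<open>2 < D\<close> unfolding bw by (simp add: eq algebra_simps diff_divide_distrib)
  finally show ?thesis using A' B by linarith
qed

lemma lower_time_nonpos:
  assumes "1 \<le> D" "D \<le> 2" "2 \<le> n"
  shows "lower_time n D \<le> 0"
proof -
  have S: "0 < shifted_square n D" "shifted_square n D \<le> 3 * n"
    using assms shifted_square_pos shifted_square_mono[of D 2 n] by (auto simp: shifted_square_def)
  have "n / 2 * ln (n / D) \<le> n / 2 * ln n"
    using assms by (intro mult_left_mono ln_mono) (auto simp: field_simps)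
  also have "\<dots> = 3 / 2 * n\<^sup>2 * ln n / (3 * n)"
    using assms by (simp add: power2_eq_square)
  also have "\<dots> \<le> 3 / 2 * n\<^sup>2 * ln n / shifted_square n D"
    using S assms by (intro divide_left_mono mult_nonneg_nonneg) auto
  finally show ?thesis by (simp add: lower_time_def)
qed

lemma lower_time_le:
  assumes "1 \<le> D" "2 \<le> n"
  shows "lower_time n D \<le> n / 2 * ln n"
proof -
  have "n / 2 * ln (n / D) \<le> n / 2 * ln n"
    using assms by (intro mult_left_mono ln_mono) (auto simp: field_simps)
  moreover have "0 \<le> 3 / 2 * n\<^sup>2 * ln n / shifted_square n D"
    using assms shifted_square_pos[of n D] by (intro divide_nonneg_pos) auto
  ultimately show ?thesis unfolding lower_time_def by linarith
qed

lemma lower_time_end: "2 \<le> n \<Longrightarrow> lower_time n n \<le> 0"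
  using shifted_square_pos[of n n] by (simp add: lower_time_def divide_nonneg_pos)

section \<open>One-step recursion for expectations\<close>

abbreviation uniform01 :: "real measure" where
  "uniform01 \<equiv> uniform_measure lborel {0..<1}"

lemma prob_space_uniform01: "prob_space uniform01"
  by (rule prob_space_uniform_measure) auto

interpretation uniform_sequence: sequence_space uniform01
  using prob_space_uniform01
  by (simp add: sequence_space_def product_prob_space_def product_prob_space_axioms_def
      product_sigma_finite_def prob_space_imp_sigma_finite)

lemma prob_space_draws: "prob_space draws"
  unfolding draws_def by (rule uniform_sequence.prob_space_axioms)

lemma measurable_draw: "(\<lambda>u. draw u s) \<in> uniform01 \<rightarrow>\<^sub>M count_space UNIV"
  by (cases s) simp

lemma measurable_urn_process: "(\<lambda>U. urn_process p s U n) \<in> draws \<rightarrow>\<^sub>M count_space UNIV"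
proof (induction n)
  case (Suc n)
  have "(\<lambda>U. draw (U n) r) \<in> draws \<rightarrow>\<^sub>M count_space UNIV" for r
    unfolding draws_def
    by (rule measurable_compose[OF _ measurable_draw]) (rule measurable_component_singleton, simp)
  then have "(\<lambda>U. draw (U n) (urn_process p s U n)) \<in> draws \<rightarrow>\<^sub>M count_space UNIV"
    by (rule measurable_compose_countable[OF _ Suc])
  then show ?case by (simp add: measurable_compose[where N="count_space UNIV"])
qed simp

text \<open>The first draw is split off instead of the last. The restarted process begins at the raw
  drawn state because \<open>p\<close> is applied at its time 0.\<close>

lemma urn_process_shift:
  "urn_process p s U (Suc n) = urn_process p (draw (U 0) (p s)) (\<lambda>i. U (Suc i)) n"
  by (induction n) simp_all

fun mean :: "(urn \<Rightarrow> real) \<Rightarrow> urn \<Rightarrow> real" where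
  "mean h (w, b) =
     (if absorbed (w, b) then h (w, b)
      else real b / real (w + b) * h (w - 1, b + 1) + real w / real (w + b) * h (w + 1, b - 1))"

lemma nn_integral_draw:
  assumes "\<And>s. 0 \<le> h s"
  shows "(\<integral>\<^sup>+u. ennreal (h (draw u s)) \<partial>uniform01) = ennreal (mean h s)"
proof (cases "absorbed s")
  case True
  then have "draw u s = s" "mean h s = h s" for u by (cases s; simp)+
  then show ?thesis
    using prob_space.emeasure_space_1[OF prob_space_uniform01] by simp
next
  case False
  obtain w b where s: "s = (w, b)" by (cases s)
  define c where "c = real w / real (w + b)"
  have c: "0 \<le> c" "c \<le> 1" and c': "real b / real (w + b) = 1 - c"
    using False by (auto simp: s c_def field_simps)
  have "AE u in uniform01. ennreal (h (draw u s)) = ennreal (h (w + 1, b - 1)) * indicator {0..<c} u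
            + ennreal (h (w - 1, b + 1)) * indicator {c..<1} u"
  proof (rule AE_uniform_measureI)
    show "AE u in lborel. u \<in> {0..<1} \<longrightarrow> ennreal (h (draw u s)) = ennreal (h (w + 1, b - 1)) * indicator {0..<c} u
            + ennreal (h (w - 1, b + 1)) * indicator {c..<1} u"
    proof (intro AE_I2 impI)
      fix u :: real assume "u \<in> {0..<1}"
      moreover have "u * real (w + b) < real w \<longleftrightarrow> u < c"
        using False by (simp add: s c_def pos_less_divide_eq)
      ultimately show "ennreal (h (draw u s)) = ennreal (h (w + 1, b - 1)) * indicator {0..<c} u
            + ennreal (h (w - 1, b + 1)) * indicator {c..<1} u"
        using False c by (auto simp: s split: split_indicator)
    qed
  qed simp
  then have "(\<integral>\<^sup>+u. ennreal (h (draw u s)) \<partial>uniform01)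
      = (\<integral>\<^sup>+u. ennreal (h (w + 1, b - 1)) * indicator {0..<c} u
            + ennreal (h (w - 1, b + 1)) * indicator {c..<1} u \<partial>uniform01)"
    by (rule nn_integral_cong_AE)
  also have "\<dots> = ennreal (h (w + 1, b - 1)) * emeasure uniform01 {0..<c}
       + ennreal (h (w - 1, b + 1)) * emeasure uniform01 {c..<1}"
    by (simp add: nn_integral_add nn_integral_cmult)
  also have "emeasure uniform01 {0..<c} = ennreal c"
    using c by (subst emeasure_uniform_measure) (auto simp: Int_absorb1 divide_ennreal_def)
  also have "emeasure uniform01 {c..<1} = ennreal (1 - c)"
    using c by (subst emeasure_uniform_measure) (auto simp: Int_absorb1 divide_ennreal_def)
  also have "ennreal (h (w + 1, b - 1)) * ennreal c + ennreal (h (w - 1, b + 1)) * ennreal (1 - c)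
      = ennreal (mean h s)"
  proof -
    have "mean h s = h (w + 1, b - 1) * c + h (w - 1, b + 1) * (1 - c)"
      using False unfolding c'[symmetric] unfolding c_def s by (simp add: mult.commute)
    then show ?thesis
      using c assms by (simp add: ennreal_mult)
  qed
  finally show ?thesis .
qed

text \<open>\<open>expectation_at p f n s\<close> is the expectation of \<open>f\<close> at time \<open>n\<close>; see \<open>nn_integral_urn_process\<close>.\<close>

primrec expectation_at :: "(urn \<Rightarrow> urn) \<Rightarrow> (urn \<Rightarrow> real) \<Rightarrow> nat \<Rightarrow> urn \<Rightarrow> real" where
  "expectation_at p f 0 s = f (p s)"
| "expectation_at p f (Suc n) s = mean (expectation_at p f n) (p s)"

lemma mean_nonneg: "(\<And>s. 0 \<le> h s) \<Longrightarrow> 0 \<le> mean h s"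
  by (cases s) (auto intro!: add_nonneg_nonneg mult_nonneg_nonneg)

lemma expectation_at_nonneg: "(\<And>s. 0 \<le> f s) \<Longrightarrow> 0 \<le> expectation_at p f n s"
  by (induction n arbitrary: s) (auto intro: mean_nonneg)

text \<open>Markov property at time 1: prefixing a uniform variable to an independent sequence of
  draws reproduces the law \<open>draws\<close>, so Fubini integrates the later draws first.\<close>

lemma nn_integral_urn_process:
  assumes "\<And>s. 0 \<le> f s"
  shows "(\<integral>\<^sup>+U. ennreal (f (urn_process p s U n)) \<partial>draws) = ennreal (expectation_at p f n s)"
proof (induction n arbitrary: s)
  case 0
  show ?case using prob_space.emeasure_space_1[OF prob_space_draws] by simp
next
  case (Suc n)
  interpret D: prob_space draws by (rule prob_space_draws)
  let ?F = "\<lambda>U. ennreal (f (urn_process p s U (Suc n)))"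
  have F: "?F \<in> borel_measurable draws"
    by (rule measurable_compose[OF measurable_urn_process]) simp
  have case_nat: "(\<lambda>(u, \<omega>). case_nat u \<omega>) \<in> uniform01 \<Otimes>\<^sub>M draws \<rightarrow>\<^sub>M draws"
    unfolding draws_def by measurable
  have "(\<integral>\<^sup>+U. ?F U \<partial>draws)
      = (\<integral>\<^sup>+U. ?F U \<partial>distr (uniform01 \<Otimes>\<^sub>M draws) draws (\<lambda>(u, \<omega>). case_nat u \<omega>))"
    by (rule arg_cong[where f="\<lambda>M. nn_integral M ?F"])
       (unfold draws_def, rule uniform_sequence.PiM_iter[symmetric])
  also have "\<dots> = (\<integral>\<^sup>+z. ?F (case z of (u, \<omega>) \<Rightarrow> case_nat u \<omega>) \<partial>(uniform01 \<Otimes>\<^sub>M draws))"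
    by (rule nn_integral_distr[OF case_nat]) (unfold measurable_distr_eq1, rule F)
  also have "\<dots> = (\<integral>\<^sup>+u. \<integral>\<^sup>+\<omega>. ?F (case_nat u \<omega>) \<partial>draws \<partial>uniform01)"
    using measurable_compose[OF case_nat F]
    by (subst D.nn_integral_fst[symmetric]) (simp_all add: split_beta)
  also have "\<dots> = (\<integral>\<^sup>+u. ennreal (expectation_at p f n (draw u (p s))) \<partial>uniform01)"
    by (simp only: urn_process_shift Suc old.nat.case)
  also have "\<dots> = ennreal (expectation_at p f (Suc n) s)"
    using assms by (simp add: nn_integral_draw expectation_at_nonneg)
  finally show ?case .
qed

definition running :: "urn \<Rightarrow> real" where
  "running s = (if absorbed s then 0 else 1)"

lemma running_nonneg: "0 \<le> running s"
  by (simp add: running_def)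

text \<open>A draw preserves the total, so only states with the same number of balls need comparing;
  inductions under a bound on the total rely on this.\<close>

lemma mean_mono:
  assumes "\<And>s. fst s + snd s = fst r + snd r \<Longrightarrow> h s \<le> h' s"
  shows "mean h r \<le> mean h' r"
  by (cases r) (auto intro!: assms add_mono mult_left_mono divide_right_mono)

lemma mean_linear: "mean (\<lambda>s. c * g s + h s) r = c * mean g r + mean h r"
  by (cases r) (simp add: algebra_simps add_divide_distrib)

lemma mean_cmult: "mean (\<lambda>s. c * g s) r = c * mean g r"
  by (cases r) (simp add: algebra_simps)

lemma mean_const: "mean (\<lambda>_. c) r = c"
  by (cases r) (auto simp: add_divide_distrib[symmetric] distrib_right[symmetric] add.commute)

lemma mean_sum: "mean (\<lambda>s. \<Sum>k<n. g k s) r = (\<Sum>k<(n::nat). mean (g k) r)"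
proof (induction n)
  case 0
  show ?case by (cases r) simp
next
  case (Suc n)
  have "mean (\<lambda>s. \<Sum>k<Suc n. g k s) r = mean (\<lambda>s. 1 * (\<Sum>k<n. g k s) + g n s) r" by simp
  then show ?case by (simp only: mean_linear Suc) simp
qed

lemma expectation_at_linear: "expectation_at p (\<lambda>s. c * g s + h s) n s = c * expectation_at p g n s + expectation_at p h n s"
proof (induction n arbitrary: s)
  case (Suc n)
  then have "expectation_at p (\<lambda>s. c * g s + h s) n = (\<lambda>s. c * expectation_at p g n s + expectation_at p h n s)" by (rule ext)
  then show ?case by (simp add: mean_linear)
qed simp

lemma expectation_at_cmult: "expectation_at p (\<lambda>s. c * g s) n s = c * expectation_at p g n s"
proof (induction n arbitrary: s)
  case (Suc n)
  then have "expectation_at p (\<lambda>s. c * g s) n = (\<lambda>s. c * expectation_at p g n s)" by (rule ext)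
  then show ?case by (simp add: mean_cmult)
qed simp

lemma expectation_at_mono: "(\<And>s. g s \<le> h s) \<Longrightarrow> expectation_at p g n s \<le> expectation_at p h n s"
  by (induction n arbitrary: s) (auto intro: mean_mono)

section \<open>Bounds for removal policies\<close>

text \<open>These properties are shared by doing nothing and by Policy A. The last two say that the
  intervention after a draw never brings the urn closer to balance than the draw itself did.\<close>

locale removal_policy =
  fixes p :: "urn \<Rightarrow> urn"
  assumes absorbed_fixed: "absorbed s \<Longrightarrow> p s = s"
    and black_majority_fixed: "w < b \<Longrightarrow> p (w, b) = (w, b)"
    and total_le: "fst (p s) + snd (p s) \<le> fst s + snd s"
    and idem: "p (p s) = p s"
    and imbalance_white: "\<lbrakk>p (w, b) = (w, b); 0 < w; 0 < b; p (w + 1, b - 1) = (w', b')\<rbrakk>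
      \<Longrightarrow> \<bar>real b - real w - 2\<bar> \<le> \<bar>real b' - real w'\<bar>"
    and imbalance_black: "\<lbrakk>p (w, b) = (w, b); 0 < w; 0 < b; p (w - 1, b + 1) = (w', b')\<rbrakk>
      \<Longrightarrow> \<bar>real b - real w + 2\<bar> \<le> \<bar>real b' - real w'\<bar>"
begin

section \<open>Absorption, survival and measurability\<close>

lemma absorbed_draw: "absorbed s \<Longrightarrow> p (draw u s) = s"
  by (cases s) (auto simp: absorbed_fixed)

lemma absorbed_stays:
  assumes "absorbed (urn_process p s U m)" "m \<le> n"
  shows "urn_process p s U n = urn_process p s U m"
  using assms(2) by (induction n rule: dec_induct) (use assms(1) absorbed_draw in auto)

lemma urn_process_total: "fst (urn_process p s U n) + snd (urn_process p s U n) \<le> fst s + snd s"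
proof (induction n)
  case (Suc n)
  have "fst (draw u r) + snd (draw u r) = fst r + snd r" for u r
    by (cases r) auto
  with Suc total_le[of "draw (U n) (urn_process p s U n)"] show ?case by simp
qed (simp add: total_le)

text \<open>Absorbed states persist, which turns the infimum into a condition on the single time
  \<open>n\<close>.\<close>

lemma absorption_time_le_iff: "absorption_time p s U \<le> enat n \<longleftrightarrow> absorbed (urn_process p s U n)"
proof
  assume *: "absorption_time p s U \<le> enat n"
  have "\<exists>m. absorbed (urn_process p s U m) \<and> m \<le> n"
  proof (rule ccontr)
    assume "\<not> ?thesis"
    then have "enat (Suc n) \<le> absorption_time p s U"
      unfolding absorption_time_def by (intro INF_greatest) (auto simp: not_le Suc_le_eq)
    with * show False by (meson Suc_n_not_le_n enat_ord_simps(1) order_trans)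
  qed
  then show "absorbed (urn_process p s U n)" by (metis absorbed_stays)
next
  assume "absorbed (urn_process p s U n)"
  then show "absorption_time p s U \<le> enat n"
    unfolding absorption_time_def by (intro INF_lower) simp
qed

text \<open>The absorption time counts the times at which the process still runs, also when it is
  infinite. Its expectation thus becomes a sum of survival probabilities.\<close>

lemma absorption_time_eq_suminf:
  "ennreal_of_enat (absorption_time p s U) = (\<Sum>n. ennreal (running (urn_process p s U n)))"
proof -
  have r: "ennreal (running (urn_process p s U n)) = (if enat n < absorption_time p s U then 1 else 0)" for n
    using absorption_time_le_iff[of s U n] by (auto simp: running_def not_le[symmetric])
  show ?thesis
  proof (cases "absorption_time p s U")
    case (enat m)
    have "(\<Sum>n. ennreal (running (urn_process p s U n))) = (\<Sum>n<m. if n < m then 1 else 0)"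
      unfolding r enat enat_ord_simps by (rule suminf_finite) auto
    then show ?thesis by (simp add: enat ennreal_of_nat_eq_real_of_nat)
  next
    case infinity
    have "(\<Sum>n::nat. (1::ennreal)) = \<infinity>"
      using nn_integral_count_space_nat[of "\<lambda>_. 1"] by simp
    then show ?thesis unfolding r by (simp add: infinity)
  qed
qed

lemma expected_absorption_time_eq:
  "expected_absorption_time p s = (\<Sum>n. ennreal (expectation_at p running n s))"
  unfolding expected_absorption_time_def absorption_time_eq_suminf
  by (subst nn_integral_suminf)
     (auto simp: nn_integral_urn_process running_nonneg intro!: measurable_compose[OF measurable_urn_process])

lemma final_black_eq:
  "absorbed (urn_process p s U n) \<Longrightarrow> final_black p s U = snd (urn_process p s U n)"
proof -
  assume *: "absorbed (urn_process p s U n)"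
  then have le: "absorption_time p s U \<le> enat n" by (simp add: absorption_time_le_iff)
  then obtain m where m: "absorption_time p s U = enat m" "m \<le> n"
    by (cases "absorption_time p s U") auto
  then have "absorbed (urn_process p s U m)" by (metis absorption_time_le_iff order_refl)
  with m absorbed_stays[of s U m n] show ?thesis by (simp add: final_black_def)
qed

lemma final_black_le: "final_black p s U \<le> fst s + snd s"
proof (cases "absorption_time p s U")
  case (enat n)
  then show ?thesis using urn_process_total[of s U n] by (simp add: final_black_def)
qed (simp add: final_black_def)

lemma measurable_absorption_time: "absorption_time p s \<in> draws \<rightarrow>\<^sub>M count_space UNIV"
proof -
  have le: "{U \<in> space draws. absorption_time p s U \<le> enat n} \<in> sets draws" for n
    unfolding absorption_time_le_iff
    using measurable_sets[OF measurable_urn_process, of "{r. absorbed r}" p s n]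
    by (auto simp: vimage_def Int_def conj_commute)
  have "absorption_time p s -` {t} \<inter> space draws \<in> sets draws" for t
  proof (cases t)
    case (enat m)
    have eq: "absorption_time p s -` {t} \<inter> space draws
      = {U \<in> space draws. absorption_time p s U \<le> enat m} - (\<Union>k<m. {U \<in> space draws. absorption_time p s U \<le> enat k})"
    proof -
      have "a = enat m \<longleftrightarrow> a \<le> enat m \<and> (\<forall>k<m. \<not> a \<le> enat k)" for a
        by (cases a) (auto simp: not_le intro: le_neq_implies_less)
      then show ?thesis by (auto simp: enat)
    qed
    show ?thesis unfolding eq by (intro sets.Diff sets.finite_UN le) simp
  next
    case infinity
    have "a = \<infinity> \<longleftrightarrow> (\<forall>k. \<not> a \<le> enat k)" for a :: enat by (cases a) auto
    then have eq: "absorption_time p s -` {t} \<inter> space draws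
      = space draws - (\<Union>k. {U \<in> space draws. absorption_time p s U \<le> enat k})"
      by (auto simp: infinity)
    show ?thesis unfolding eq by (intro sets.Diff sets.countable_UN sets.top) (auto simp: le)
  qed
  then show ?thesis by (simp add: measurable_count_space_eq2_countable)
qed

lemma measurable_final_black: "(\<lambda>U. real (final_black p s U)) \<in> borel_measurable draws"
  unfolding final_black_def
proof (rule measurable_compose_countable[OF _ measurable_absorption_time])
  fix t :: enat
  have "(\<lambda>U. case t of enat n \<Rightarrow> snd (urn_process p s U n) | \<infinity> \<Rightarrow> 0) \<in> draws \<rightarrow>\<^sub>M count_space UNIV"
    by (cases t) (auto intro!: measurable_compose[OF measurable_urn_process])
  then show "(\<lambda>U. real (case t of enat n \<Rightarrow> snd (urn_process p s U n) | \<infinity> \<Rightarrow> 0)) \<in> borel_measurable draws"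
    by (rule measurable_compose) simp
qed

text \<open>
  With \<open>c = 1\<close> this bounds the expected absorption time from above, with \<open>c = - 1\<close> and \<open>- f\<close> in
  place of \<open>f\<close> from below, and with \<open>c = 0\<close> it is optional stopping for supermartingales.
\<close>

lemma supermartingale_bound:
  assumes step: "\<And>r. \<lbrakk>p r = r; fst r + snd r \<le> N\<rbrakk> \<Longrightarrow> c * running r + mean (\<lambda>s. f (p s)) r \<le> f r"
    and "fst s + snd s \<le> N"
  shows "c * (\<Sum>k<n. expectation_at p running k s) + expectation_at p f n s \<le> f (p s)"
  using assms(2)
proof (induction n arbitrary: s)
  case (Suc n)
  let ?r = "p s"
  have total: "fst ?r + snd ?r \<le> N" using Suc.prems total_le[of s] by simp
  have "c * (\<Sum>k<Suc n. expectation_at p running k s) + expectation_at p f (Suc n) s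
      = c * running ?r + mean (\<lambda>s. c * (\<Sum>k<n. expectation_at p running k s) + expectation_at p f n s) ?r"
    unfolding sum.lessThan_Suc_shift mean_linear mean_sum by (simp add: algebra_simps)
  also have "\<dots> \<le> c * running ?r + mean (\<lambda>s. f (p s)) ?r"
    using total by (intro add_left_mono mean_mono Suc.IH) simp
  also have "\<dots> \<le> f ?r" by (rule step[OF idem total])
  finally show ?case .
qed simp

lemma absorbed_step: "\<lbrakk>absorbed r; p r = r\<rbrakk> \<Longrightarrow> c * running r + mean (\<lambda>s. f (p s)) r = f r"
  by (cases r) (simp add: running_def)

section \<open>Two-sided bounds for the expected absorption time\<close>

lemma running_sum_le:
  assumes "2 \<le> N" "fst s + snd s \<le> N" "p s = (w, b)"
  shows "(\<Sum>k<n. expectation_at p running k s) \<le> upper_time N (real b - real w)"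
proof -
  \<comment> \<open>The value 0 for larger totals only makes \<open>F\<close> nonnegative
    everywhere; such urns are never reached.\<close>
  define F where "F = (\<lambda>(w, b). if w + b \<le> N then upper_time N (real b - real w) else 0)"
  have F_nonneg: "0 \<le> F r" for r
    using \<open>2 \<le> N\<close> by (auto simp: F_def split: prod.split intro!: upper_time_nonneg)
  have "1 * (\<Sum>k<n. expectation_at p running k s) + expectation_at p F n s \<le> F (p s)"
  proof (rule supermartingale_bound[OF _ assms(2)])
    fix r assume r: "p r = r" "fst r + snd r \<le> N"
    show "1 * running r + mean (\<lambda>s. F (p s)) r \<le> F r"
    proof (cases "absorbed r")
      case True
      then show ?thesis using absorbed_step[of r 1 F] r by simp
    next
      case False
      obtain w b where wb: "r = (w, b)" by (cases r)
      have pos: "0 < w" "0 < b" and le: "w + b \<le> N" using False r by (auto simp: wb)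
      \<comment> \<open>The value after the intervention is compared with \<open>upper_time\<close>
        at the imbalance \<open>D\<close> that the draw alone produced.\<close>
      have F_p: "F (p v) \<le> upper_time N D" if "fst v + snd v = w + b"
        "\<And>w' b'. p v = (w', b') \<Longrightarrow> \<bar>D\<bar> \<le> \<bar>real b' - real w'\<bar>" for v D
      proof -
        obtain w' b' where v: "p v = (w', b')" by (cases "p v")
        have "w' + b' \<le> N" using total_le[of v] v that(1) le by simp
        then show ?thesis using upper_time_antimono[OF that(2)[OF v], of N] \<open>2 \<le> N\<close>
          by (simp add: F_def v)
      qed
      have "F (p (w + 1, b - 1)) \<le> upper_time N (real b - real w - 2)"
        using imbalance_white[of w b] r pos by (intro F_p) (auto simp: wb)
      moreover have "F (p (w - 1, b + 1)) \<le> upper_time N (real b - real w + 2)"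
        using imbalance_black[of w b] r pos by (intro F_p) (auto simp: wb)
      ultimately have "1 + mean (\<lambda>s. F (p s)) r \<le> 1 + (real b / (real w + real b) * upper_time N (real b - real w + 2)
          + real w / (real w + real b) * upper_time N (real b - real w - 2))"
        using False unfolding wb mean.simps of_nat_add
        by (simp only: if_False) (intro add_left_mono add_mono mult_left_mono; simp)
      also have "\<dots> \<le> upper_time N (real b - real w)"
        using upper_time_drift[of w b N] pos le \<open>2 \<le> N\<close> by simp
      finally show ?thesis using False le by (simp add: wb running_def F_def)
    qed
  qed
  moreover have "F (p s) = upper_time N (real b - real w)"
    using assms total_le[of s] by (simp add: F_def)
  ultimately show ?thesis using expectation_at_nonneg[of F p n s] F_nonneg by simp
qed

lemma summable_running:
  assumes "2 \<le> N" "fst s + snd s \<le> N"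
  shows "summable (\<lambda>k. expectation_at p running k s)"
proof -
  obtain w b where wb: "p s = (w, b)" by (cases "p s")
  show ?thesis
    by (rule summableI_nonneg_bounded[OF _ running_sum_le[OF assms wb]]) (simp add: expectation_at_nonneg running_nonneg)
qed

lemma expected_time_eq:
  assumes "2 \<le> N" "fst s + snd s \<le> N"
  shows "enn2real (expected_absorption_time p s) = (\<Sum>k. expectation_at p running k s)"
  unfolding expected_absorption_time_eq using summable_running[OF assms]
  by (subst suminf_ennreal2) (auto simp: expectation_at_nonneg running_nonneg suminf_nonneg)

lemma expected_time_le:
  assumes "2 \<le> N" "fst s + snd s \<le> N" "p s = (w, b)"
  shows "enn2real (expected_absorption_time p s) \<le> upper_time N (real b - real w)"
  unfolding expected_time_eq[OF assms(1,2)]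
  by (intro suminf_le_const summable_running[OF assms(1,2)] running_sum_le assms)

lemma expected_time_ge:
  fixes N w b :: nat
  assumes "2 \<le> N" "w + b = N" "w < b"
  shows "lower_time N (real b - real w) \<le> enn2real (expected_absorption_time p (w, b))"
proof -
  \<comment> \<open>\<open>G\<close> is 0 once a ball was removed or white has caught up, so
    interventions can only help the lower bound.\<close>
  define G where "G = (\<lambda>(w, b). if w + b = N \<and> w < b then max 0 (lower_time N (real b - real w)) else 0)"
  define B where "B = real N / 2 * ln N"
  let ?s = "(w, b)"
  have G_nonneg: "0 \<le> G r" for r by (auto simp: G_def split: prod.split)
  have "0 \<le> B" using assms by (simp add: B_def)
  \<comment> \<open>\<open>G\<close> vanishes at absorption, by \<open>lower_time_end\<close> when
    all \<open>N\<close> balls are black. Hence the remainder at time \<open>n\<close> is at most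
    \<open>B\<close> times the survival probability.\<close>
  have G_le: "G r \<le> B * running r" for r
  proof (cases r)
    case (Pair w b)
    show ?thesis
    proof (cases "w + b = N \<and> w < b")
      case True
      show ?thesis
      proof (cases "w = 0")
        case True
        then show ?thesis using lower_time_end[of N] \<open>2 \<le> N\<close> \<open>w + b = N \<and> w < b\<close>
          by (simp add: Pair G_def running_def)
      next
        case False
        have "lower_time N (real b - real w) \<le> B"
          using lower_time_le[of "real b - real w" N] \<open>2 \<le> N\<close> True by (simp add: B_def)
        then show ?thesis using False True \<open>0 \<le> B\<close>
          by (simp add: Pair G_def running_def)
      qed
    next
      case False
      then show ?thesis using \<open>0 \<le> B\<close> by (auto simp: Pair G_def running_def)
    qed
  qed
  have step: "- 1 * running r + mean (\<lambda>s. - 1 * G (p s)) r \<le> - 1 * G r"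
    if r: "p r = r" "fst r + snd r \<le> N" for r
  proof (cases "absorbed r")
    case True
    then show ?thesis using absorbed_step[of r "- 1" "\<lambda>s. - 1 * G s"] r by simp
  next
    case False
    obtain w b where wb: "r = (w, b)" by (cases r)
    have pos: "0 < w" "0 < b" using False by (auto simp: wb)
    have mean_G: "0 \<le> mean (\<lambda>s. G (p s)) r" by (rule mean_nonneg) (rule G_nonneg)
    have "G r \<le> 1 + mean (\<lambda>s. G (p s)) r"
    proof (cases "w + b = N \<and> w < b \<and> 0 < lower_time N (real b - real w)")
      case False
      then have "G r = 0" by (auto simp: wb G_def)
      then show ?thesis using mean_G by simp
    next
      case True
      \<comment> \<open>A positive \<open>lower_time\<close> excludes \<open>D \<le> 2\<close>; both
        successors then keep a strict black majority and \<open>p\<close> leaves them alone.\<close>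
      have "w + 2 < b"
      proof (rule ccontr)
        assume "\<not> ?thesis"
        then have "lower_time N (real b - real w) \<le> 0"
          using True \<open>2 \<le> N\<close> by (intro lower_time_nonpos) auto
        with True show False by simp
      qed
      then have p: "p (w + 1, b - 1) = (w + 1, b - 1)" "p (w - 1, b + 1) = (w - 1, b + 1)"
        by (auto intro!: black_majority_fixed)
      have "G (w + 1, b - 1) \<ge> lower_time N (real b - real w - 2)"
        "G (w - 1, b + 1) \<ge> lower_time N (real b - real w + 2)"
        using \<open>w + 2 < b\<close> True pos by (auto simp: G_def of_nat_diff algebra_simps)
      then have "1 + (real b / real N * lower_time N (real b - real w + 2) + real w / real N * lower_time N (real b - real w - 2))
          \<le> 1 + (real b / real N * G (w - 1, b + 1) + real w / real N * G (w + 1, b - 1))"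
        by (intro add_left_mono add_mono mult_left_mono) auto
      also have "\<dots> = 1 + mean (\<lambda>s. G (p s)) r"
        using \<open>\<not> absorbed r\<close> True unfolding wb mean.simps by (simp only: p if_False)
      finally have "1 + (real b / real N * lower_time N (real b - real w + 2) + real w / real N * lower_time N (real b - real w - 2))
          \<le> 1 + mean (\<lambda>s. G (p s)) r" .
      moreover have "lower_time N (real b - real w) \<le> 1 + real b / real N * lower_time N (real b - real w + 2)
          + real w / real N * lower_time N (real b - real w - 2)"
        using True \<open>w + 2 < b\<close> pos \<open>2 \<le> N\<close> by (intro lower_time_drift) auto
      moreover have "G r = lower_time N (real b - real w)" using True by (simp add: wb G_def)
      ultimately show ?thesis by simp
    qed
    then show ?thesis using False by (simp only: mean_cmult) (simp add: running_def)
  qed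
  have "G ?s \<le> (\<Sum>k<n. expectation_at p running k ?s) + B * expectation_at p running n ?s" for n
  proof -
    have "- 1 * (\<Sum>k<n. expectation_at p running k ?s) + expectation_at p (\<lambda>s. - 1 * G s) n ?s \<le> - 1 * G (p ?s)"
      using assms by (intro supermartingale_bound[where N=N] step) auto
    moreover have "expectation_at p G n ?s \<le> expectation_at p (\<lambda>s. B * running s) n ?s"
      by (intro expectation_at_mono G_le)
    ultimately show ?thesis
      unfolding expectation_at_cmult black_majority_fixed[OF \<open>w < b\<close>] by simp
  qed
  moreover have summable: "summable (\<lambda>k. expectation_at p running k ?s)"
    using assms by (intro summable_running[of N]) auto
  \<comment> \<open>Survival probabilities are summable, so the remainder tends to 0.\<close>
  have "(\<lambda>n. (\<Sum>k<n. expectation_at p running k ?s) + B * expectation_at p running n ?s) \<longlonglongrightarrow> (\<Sum>k. expectation_at p running k ?s) + B * 0"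
    by (intro tendsto_intros summable_LIMSEQ summable summable_LIMSEQ_zero)
  ultimately have "G ?s \<le> (\<Sum>k. expectation_at p running k ?s) + B * 0"
    by (intro LIMSEQ_le_const) auto
  moreover have "lower_time N (real b - real w) \<le> G ?s" using assms by (simp add: G_def)
  ultimately show ?thesis using assms by (simp add: expected_time_eq[of N])
qed

section \<open>Bounds for the expected final number of black balls\<close>

lemma expected_final_black_le: "expected_final_black p s \<le> real (fst s + snd s)"
proof -
  interpret D: prob_space draws by (rule prob_space_draws)
  show ?thesis unfolding expected_final_black_def
    using final_black_le[of s]
    by (intro D.integral_le_const D.integrable_const_bound[where B="real (fst s + snd s)"]
        measurable_final_black) (auto simp del: of_nat_add)
qed

text \<open>The capped function \<open>\<psi>\<close> is a supermartingale that dominates the number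
  of missing black balls at absorption; paths still running at time \<open>k\<close> miss at most
  \<open>N\<close> each, and their probability vanishes.\<close>

lemma expected_final_black_ge:
  fixes N w b :: nat
  assumes "2 \<le> N" "w + b = N" "w < b"
  shows "real N - 3 * (real N)\<^sup>2 / shifted_square N (real b - real w) \<le> expected_final_black p (w, b)"
proof -
  interpret D: prob_space draws by (rule prob_space_draws)
  let ?K = "3 * (real N)\<^sup>2" and ?S = "shifted_square N"
  \<comment> \<open>The factor 3 matches \<open>?S 2 = 3 * N\<close>: for \<open>D \<le> 2\<close>
    the cap \<open>N\<close> is attained, and the supermartingale inequality holds there because
    \<open>\<psi>\<close> never exceeds \<open>N\<close>.\<close>
  define \<psi> where "\<psi> = (\<lambda>(w, b). if w + b = N \<and> w < b then min (real N) (?K / ?S (real b - real w)) else real N)"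
  let ?s = "(w, b)"
  have S: "0 < ?S x" for x using shifted_square_pos[of N x] \<open>2 \<le> N\<close> by simp
  have \<psi>_nonneg: "0 \<le> \<psi> r" for r using S by (auto simp: \<psi>_def less_imp_le split: prod.split)
  have \<psi>_le: "\<psi> r \<le> real N" for r by (auto simp: \<psi>_def split: prod.split)
  have step: "0 * running r + mean (\<lambda>s. \<psi> (p s)) r \<le> \<psi> r"
    if r: "p r = r" "fst r + snd r \<le> N" for r
  proof (cases "absorbed r")
    case True
    then show ?thesis using absorbed_step[of r 0 \<psi>] r by simp
  next
    case False
    obtain w b where wb: "r = (w, b)" by (cases r)
    have pos: "0 < w" "0 < b" using False by (auto simp: wb)
    have "mean (\<lambda>s. \<psi> (p s)) r \<le> mean (\<lambda>_. real N) r" by (intro mean_mono \<psi>_le)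
    also have "\<dots> = real N" by (rule mean_const)
    finally have N: "mean (\<lambda>s. \<psi> (p s)) r \<le> real N" .
    show ?thesis
    proof (cases "w + b = N \<and> w + 2 < b")
      case True
      then have p: "p (w + 1, b - 1) = (w + 1, b - 1)" "p (w - 1, b + 1) = (w - 1, b + 1)"
        by (auto intro!: black_majority_fixed)
      have "\<psi> (w + 1, b - 1) \<le> ?K / ?S (real b - real w - 2)" "\<psi> (w - 1, b + 1) \<le> ?K / ?S (real b - real w + 2)"
        using True pos by (auto simp: \<psi>_def of_nat_diff algebra_simps)
      then have "mean (\<lambda>s. \<psi> (p s)) r \<le> real b / real (w + b) * (?K / ?S (real b - real w + 2))
           + real w / real (w + b) * (?K / ?S (real b - real w - 2))"
        using \<open>\<not> absorbed r\<close> unfolding wb mean.simps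
        by (simp only: p if_False) (intro add_mono mult_left_mono; simp)
      also have "\<dots> = ?K * (real b / (real w + real b) / ?S (real b - real w + 2) + real w / (real w + real b) / ?S (real b - real w - 2))"
        by (simp add: distrib_left mult.commute)
      also have "\<dots> \<le> ?K * (1 / ?S (real b - real w))"
        using pos True \<open>2 \<le> N\<close> by (intro mult_left_mono recip_superharmonic) auto
      finally show ?thesis using N True by (simp add: wb \<psi>_def)
    next
      case False
      have "real N \<le> ?K / ?S (real b - real w)" if "w + b = N" "w < b"
      proof -
        have "?S (real b - real w) \<le> ?S 2"
          using that False by (intro shifted_square_mono) auto
        then have "?S (real b - real w) \<le> 3 * real N" by (simp add: shifted_square_def)
        then have "real N * ?S (real b - real w) \<le> ?K"
          using mult_left_mono[of "?S (real b - real w)" "3 * real N" "real N"] by (simp add: power2_eq_square)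
        then show ?thesis using S by (simp add: pos_le_divide_eq)
      qed
      then have "\<psi> r = real N" by (auto simp: wb \<psi>_def)
      then show ?thesis using N by simp
    qed
  qed
  let ?X = "\<lambda>k U. urn_process p ?s U k" and ?fb = "\<lambda>U. real (final_black p ?s U)"
  have int: "integrable draws ?fb"
    using final_black_le[of ?s] assms
    by (intro D.integrable_const_bound[where B="real N"] measurable_final_black) auto
  have fb_le: "?fb U \<le> real N" for U using final_black_le[of ?s U] assms by simp
  have bound: "real N - expected_final_black p ?s \<le> \<psi> ?s + real N * expectation_at p running k ?s" for k
  proof -
    have pw: "real N - ?fb U \<le> real N * running (?X k U) + \<psi> (?X k U)" for U
    proof (cases "absorbed (?X k U)")
      case True
      obtain w' b' where X: "?X k U = (w', b')" by (cases "?X k U")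
      have "?fb U = real b'" using final_black_eq[OF True] by (simp add: X)
      moreover have "real N - real b' \<le> \<psi> (w', b')"
      proof (cases "w' + b' = N \<and> w' < b'")
        case True': True
        \<comment> \<open>An absorbed urn with a strict black majority has no white ball, so nothing
          is missing here. In every other case \<open>\<psi>\<close> is \<open>N\<close>.\<close>
        then have "b' = N" using True X by auto
        then show ?thesis using \<psi>_nonneg by simp
      next
        case False
        then show ?thesis by (auto simp: \<psi>_def)
      qed
      ultimately show ?thesis using True by (simp add: X running_def)
    next
      case False
      then show ?thesis using \<psi>_nonneg[of "?X k U"] by (simp add: running_def)
    qed
    have "ennreal (\<integral>U. real N - ?fb U \<partial>draws) = (\<integral>\<^sup>+U. ennreal (real N - ?fb U) \<partial>draws)"
      using int fb_le by (intro nn_integral_eq_integral[symmetric]) auto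
    also have "\<dots> \<le> (\<integral>\<^sup>+U. ennreal (real N * running (?X k U) + \<psi> (?X k U)) \<partial>draws)"
      by (intro nn_integral_mono ennreal_leI pw)
    also have "\<dots> = ennreal (real N * expectation_at p running k ?s + expectation_at p \<psi> k ?s)"
      using \<psi>_nonneg running_nonneg
      by (subst nn_integral_urn_process[where f="\<lambda>r. real N * running r + \<psi> r"]) (auto simp: expectation_at_linear)
    finally have "(\<integral>U. real N - ?fb U \<partial>draws) \<le> real N * expectation_at p running k ?s + expectation_at p \<psi> k ?s"
      by (subst (asm) ennreal_le_iff)
         (intro add_nonneg_nonneg mult_nonneg_nonneg expectation_at_nonneg \<psi>_nonneg running_nonneg of_nat_0_le_iff)
    moreover have "(\<integral>U. real N - ?fb U \<partial>draws) = real N - expected_final_black p ?s"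
      using int unfolding expected_final_black_def by (simp add: D.prob_space)
    moreover have "0 * (\<Sum>j<k. expectation_at p running j ?s) + expectation_at p \<psi> k ?s \<le> \<psi> (p ?s)"
      using assms by (intro supermartingale_bound[where N=N] step) auto
    ultimately show ?thesis by (simp add: black_majority_fixed[OF \<open>w < b\<close>])
  qed
  have "summable (\<lambda>k. expectation_at p running k ?s)"
    using assms by (intro summable_running[of N]) auto
  then have "(\<lambda>k. \<psi> ?s + real N * expectation_at p running k ?s) \<longlonglongrightarrow> \<psi> ?s + real N * 0"
    by (intro tendsto_intros summable_LIMSEQ_zero)
  then have "real N - expected_final_black p ?s \<le> \<psi> ?s + real N * 0"
    by (rule LIMSEQ_le_const) (use bound in auto)
  then show ?thesis using assms by (simp add: \<psi>_def)
qed

section \<open>Asymptotics for an imbalance within 2 of \<open>y * N\<close>\<close>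

context
  fixes y :: real and w b :: "nat \<Rightarrow> nat"
  assumes y: "0 < y" "y < 1"
    and total: "\<And>N. N > 0 \<Longrightarrow> w N + b N = N"
    and imbalance: "\<And>N. N > 0 \<Longrightarrow> y * real N \<le> real (b N) - real (w N)"
      "\<And>N. N > 0 \<Longrightarrow> real (b N) - real (w N) \<le> y * real N + 2"
begin

lemma black_majority: "N > 0 \<Longrightarrow> w N < b N"
  using imbalance(1)[of N] y by (smt (verit) mult_pos_pos of_nat_0_less_iff of_nat_less_iff)

lemma shifted_square_ge:
  assumes "2 \<le> N"
  shows "(y * real N)\<^sup>2 \<le> shifted_square N (real (b N) - real (w N))"
proof -
  have "(y * real N)\<^sup>2 \<le> (real (b N) - real (w N))\<^sup>2"
    using imbalance(1)[of N] assms y by (intro power_mono) auto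
  then show ?thesis using assms by (simp add: shifted_square_def)
qed

lemma asymp_expected_final_black:
  "(\<lambda>N. expected_final_black p (w N, b N)) \<sim>[sequentially] real"
proof -
  have lower: "\<forall>\<^sub>F N in sequentially. real N - 3 / y\<^sup>2 \<le> expected_final_black p (w N, b N)"
    using eventually_ge_at_top[of 2]
  proof eventually_elim
    case (elim N)
    have "3 * (real N)\<^sup>2 / shifted_square N (real (b N) - real (w N)) \<le> 3 * (real N)\<^sup>2 / (y * real N)\<^sup>2"
      using shifted_square_ge[OF elim] y elim shifted_square_pos[of N]
      by (intro divide_left_mono mult_pos_pos) auto
    also have "\<dots> = 3 / y\<^sup>2" using elim by (simp add: power_mult_distrib)
    finally show ?case
      using expected_final_black_ge[of N "w N" "b N"] total[of N] black_majority[of N] elim by simp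
  qed
  have upper: "\<forall>\<^sub>F N in sequentially. expected_final_black p (w N, b N) \<le> real N"
    using eventually_gt_at_top[of 0]
  proof eventually_elim
    case (elim N)
    then show ?case using expected_final_black_le[of "(w N, b N)"] total[of N] by simp
  qed
  have "(\<lambda>N. real N - 3 / y\<^sup>2) \<sim>[sequentially] real"
    using y by real_asymp
  then show ?thesis
    by (rule asymp_equiv_sandwich_real[OF _ asymp_equiv_refl]) (use eventually_conj[OF lower upper] in simp)
qed

lemma asymp_expected_absorption_time:
  "(\<lambda>N. enn2real (expected_absorption_time p (w N, b N))) \<sim>[sequentially] (\<lambda>N. real N / 2 * ln (1 / y))"
proof -
  have lower: "\<forall>\<^sub>F N in sequentially. real N / 2 * ln (real N / (y * real N + 2)) - 3 / 2 * ln (real N) / y\<^sup>2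
      \<le> enn2real (expected_absorption_time p (w N, b N))"
    using eventually_ge_at_top[of 2]
  proof eventually_elim
    case (elim N)
    let ?D = "real (b N) - real (w N)"
    have D: "0 < ?D" "?D \<le> y * real N + 2"
      using black_majority[of N] imbalance(2)[of N] elim by auto
    have "real N / 2 * ln (real N / (y * real N + 2)) \<le> real N / 2 * ln (real N / ?D)"
      using D elim y by (intro mult_left_mono ln_mono divide_left_mono mult_pos_pos divide_pos_pos add_nonneg_pos) auto
    moreover have "3 / 2 * (real N)\<^sup>2 * ln (real N) / shifted_square N ?D \<le> 3 / 2 * (real N)\<^sup>2 * ln (real N) / (y * real N)\<^sup>2"
      using shifted_square_ge[OF elim] y elim shifted_square_pos[of N]
      by (intro divide_left_mono mult_pos_pos mult_nonneg_nonneg) auto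
    moreover have "\<dots> = 3 / 2 * ln (real N) / y\<^sup>2" using elim by (simp add: power_mult_distrib)
    moreover have "lower_time N ?D \<le> enn2real (expected_absorption_time p (w N, b N))"
      using total[of N] black_majority[of N] elim by (intro expected_time_ge) auto
    ultimately show ?case unfolding lower_time_def by linarith
  qed
  \<comment> \<open>The logarithm tends to \<open>2 * ln (1 / y)\<close>, which turns the factor
    \<open>N / 4\<close> into the leading term \<open>N / 2 * ln (1 / y)\<close>.\<close>
  have upper: "\<forall>\<^sub>F N in sequentially. enn2real (expected_absorption_time p (w N, b N))
      \<le> real N / 4 * ln (((real N)\<^sup>2 + 3 * real N) / (y * real N)\<^sup>2) + 6 / y\<^sup>2"
    using eventually_ge_at_top[of 2]
  proof eventually_elim
    case (elim N)
    let ?D = "real (b N) - real (w N)"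
    note S = shifted_square_ge[OF elim]
    have pos: "0 < (y * real N)\<^sup>2" "0 < shifted_square N ?D" "0 < (real N)\<^sup>2 + 3 * real N"
      using y elim shifted_square_pos[of N] by (auto intro!: add_pos_pos)
    have "real N / 4 * ln (((real N)\<^sup>2 + 3 * real N) / shifted_square N ?D)
        \<le> real N / 4 * ln (((real N)\<^sup>2 + 3 * real N) / (y * real N)\<^sup>2)"
      using S pos by (intro mult_left_mono ln_mono divide_left_mono mult_pos_pos divide_pos_pos) auto
    moreover have "6 * (real N)\<^sup>2 / shifted_square N ?D \<le> 6 * (real N)\<^sup>2 / (y * real N)\<^sup>2"
      using S pos by (intro divide_left_mono mult_pos_pos) auto
    moreover have "\<dots> = 6 / y\<^sup>2" using elim by (simp add: power_mult_distrib)
    moreover have "enn2real (expected_absorption_time p (w N, b N)) \<le> upper_time N ?D"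
      using total[of N] black_majority[of N] elim by (intro expected_time_le black_majority_fixed) auto
    ultimately show ?case unfolding upper_time_def by linarith
  qed
  \<comment> \<open>The sign shows that the leading coefficient is nonzero.\<close>
  have ln_y: "ln y < 0" "ln (1 / y) = - ln y" using y by (simp_all add: ln_div)
  show ?thesis
  proof (rule asymp_equiv_sandwich_real)
    show "(\<lambda>N. real N / 2 * ln (real N / (y * real N + 2)) - 3 / 2 * ln (real N) / y\<^sup>2)
        \<sim>[sequentially] (\<lambda>N. real N / 2 * ln (1 / y))"
      unfolding ln_y(2) using y ln_y(1) by (intro asymp_equivI') (real_asymp simp: ln_inverse ln_realpow)
    show "(\<lambda>N. real N / 4 * ln (((real N)\<^sup>2 + 3 * real N) / (y * real N)\<^sup>2) + 6 / y\<^sup>2)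
        \<sim>[sequentially] (\<lambda>N. real N / 2 * ln (1 / y))"
      unfolding ln_y(2) using y ln_y(1) by (intro asymp_equivI') (real_asymp simp: ln_inverse ln_realpow)
  qed (use eventually_conj[OF lower upper] in simp)
qed

end

end

section \<open>The process without intervention and under Policy A\<close>

interpretation M: removal_policy id
  by unfold_locales auto

interpretation A: removal_policy policyA
proof
  fix s w b w' b'
  show "absorbed s \<Longrightarrow> policyA s = s" by (cases s) auto
  show "w < b \<Longrightarrow> policyA (w, b) = (w, b)" by simp
  show "fst (policyA s) + snd (policyA s) \<le> fst s + snd s" by (cases s) auto
  show "policyA (policyA s) = policyA s" by (cases s) auto
  \<comment> \<open>Policy A acts after a white draw only if \<open>b - w\<close> was 1 or 2. The
    draw makes the imbalance \<open>- 1\<close> or 0, and the policy resets it to 1.\<close>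
  show "\<lbrakk>policyA (w, b) = (w, b); 0 < w; 0 < b; policyA (w + 1, b - 1) = (w', b')\<rbrakk>
      \<Longrightarrow> \<bar>real b - real w - 2\<bar> \<le> \<bar>real b' - real w'\<bar>"
    by (auto split: if_splits)
  show "\<lbrakk>policyA (w, b) = (w, b); 0 < w; 0 < b; policyA (w - 1, b + 1) = (w', b')\<rbrakk>
      \<Longrightarrow> \<bar>real b - real w + 2\<bar> \<le> \<bar>real b' - real w'\<bar>"
    by (auto split: if_splits)
qed

theorem proposition2p5:
  fixes x :: real and w b :: "nat \<Rightarrow> nat"
  assumes "1 / 2 < x" and "x < 1"
    and "\<And>N. N > 0 \<Longrightarrow> b N = nat \<lceil>x * real N\<rceil>"
    and "\<And>N. N > 0 \<Longrightarrow> w N = nat \<lfloor>(1 - x) * real N\<rfloor>"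
  shows "((\<lambda>N. VA (w N) (b N)) \<sim>[sequentially] (\<lambda>N. V (w N) (b N)))
       \<and> ((\<lambda>N. V (w N) (b N)) \<sim>[sequentially] (\<lambda>N. real N))
       \<and> ((\<lambda>N. TA (w N) (b N)) \<sim>[sequentially] (\<lambda>N. T (w N) (b N)))
       \<and> ((\<lambda>N. T (w N) (b N)) \<sim>[sequentially] (\<lambda>N. real N / 2 * ln (1 / (2 * x - 1))))"
proof -
  define y where "y = 2 * x - 1"
  have y: "0 < y" "y < 1" using assms(1,2) by (auto simp: y_def)
  have total: "w N + b N = N" if "N > 0" for N
  proof -
    \<comment> \<open>Rounding \<open>(1 - x) * N\<close> down complements rounding
      \<open>x * N\<close> up, so the urn holds exactly \<open>N\<close> balls and the imbalance is
      \<open>2 * \<lceil>x * N\<rceil> - N\<close>.\<close>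
    have "\<lfloor>(1 - x) * real N\<rfloor> = int N - \<lceil>x * real N\<rceil>"
      by (rule floor_unique) (use ceiling_correct[of "x * real N"] in \<open>simp_all add: algebra_simps\<close>)
    moreover have "0 \<le> \<lceil>x * real N\<rceil>" using assms by (simp add: less_le_trans[of _ 0])
    moreover have "0 \<le> \<lfloor>(1 - x) * real N\<rfloor>" using assms by simp
    ultimately show ?thesis using assms(3,4)[OF that] by linarith
  qed
  have imbalance: "y * real N \<le> real (b N) - real (w N)" "real (b N) - real (w N) \<le> y * real N + 2" if "N > 0" for N
  proof -
    have "0 \<le> x * real N" using assms by simp
    then have "real (b N) = of_int \<lceil>x * real N\<rceil>" using assms(3)[OF that] by simp
    moreover have "real (w N) = real N - real (b N)" using total[OF that] by linarith
    moreover have "y * real N = 2 * (x * real N) - real N" by (simp add: y_def algebra_simps)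
    ultimately show "y * real N \<le> real (b N) - real (w N)" "real (b N) - real (w N) \<le> y * real N + 2"
      by linarith+
  qed
  note hyps = y total imbalance
  have V: "(\<lambda>N. V (w N) (b N)) \<sim>[sequentially] real" and VA: "(\<lambda>N. VA (w N) (b N)) \<sim>[sequentially] real"
    unfolding V_def VA_def
    by (rule M.asymp_expected_final_black[OF hyps] A.asymp_expected_final_black[OF hyps]; assumption)+
  have T: "(\<lambda>N. T (w N) (b N)) \<sim>[sequentially] (\<lambda>N. real N / 2 * ln (1 / y))"
    and TA: "(\<lambda>N. TA (w N) (b N)) \<sim>[sequentially] (\<lambda>N. real N / 2 * ln (1 / y))"
    unfolding T_def TA_def
    by (rule M.asymp_expected_absorption_time[OF hyps] A.asymp_expected_absorption_time[OF hyps]; assumption)+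
  show ?thesis
    using asymp_equiv_trans[OF VA asymp_equiv_symI[OF V]] V
      asymp_equiv_trans[OF TA asymp_equiv_symI[OF T]] T
    by (simp add: y_def)
qed

end
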